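(* Let $N\ge 2$ be fixed. For each $n\in\mathbb{N}$ let $\mathbf{Y}^{(n)}=(\mathbf{Y}^{(n)}_k)_{k\ge 0}$ be the discrete-space discrete-time exchange process on $\Delta_{N-1}(n)$ with initial law $\mu_0^{(n)}$ driven by the uniform variables $\{U^{(n)}_{i,j}(k)\}_{i,j,k}$, and let $\mathcal{P}^n$ be its law on $(\Delta_{N-1})^{\mathbb{N}_0}$. Let $\mathbf{X}^{(\infty)}=(\mathbf{X}^{(\infty)}_k)_{k\ge 0}$ be the continuous-space discrete-time exchange process on $\Delta_{N-1}$ with initial law $\mu_0^{(\infty)}$ driven by $\{U^{(\infty)}_{i,j}(k)\}_{i,j,k}$, and let $\mathcal{P}^\infty$ be its law on $(\Delta_{N-1})^{\mathbb{N}_0}$. Assume that $\mu_0^{(n)}\Rightarrow\mu_0^{(\infty)}$ weakly as $n\to\infty$. Assume furthermore the weak convergence, as $n\to\infty$, of the i.i.d. sequences $$\{U^{(n)}_{i,j}(k)\}_{i,j,k}\Longrightarrow\{U^{(\infty)}_{i,j}(k)\}_{i,j,k},$$ where the limiting sequence is a sequence of i.i.d. uniform $[0,1]$ random variables that are also independent of the initial state with law $\mu_0^{(\infty)}$. Then $\mathcal{P}^n\Rightarrow\mathcal{P}^\infty$ weakly as $n\to\infty$.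
   Context: $\Delta_{N-1}=\{(x_1,\dots,x_N): x_i\ge 0,\ \sum_{i=1}^N x_i=1\}$ and $\Delta_{N-1}(n)=\{(q_1,\dots,q_N): 0\le q_i\le 1,\ \sum_i q_i=1,\ nq_i\in\mathbb{N}_0\}\subset\Delta_{N-1}$. The space $(\Delta_{N-1})^{\mathbb{N}_0}$ carries the product topology. For $x\ge 0$ let $[x]_n=a/n$ where $a\in\mathbb{N}_0$ is such that $a/n\le x<(a+1)/n$. Discrete-space process: for each $n$, $\{U^{(n)}_{i,j}(k): 1\le i,j\le N,\ i\ne j,\ k\in\mathbb{N}_0\}$ are i.i.d. uniform on $[0,1]$, independent of the initial state $\mathbf{Y}^{(n)}_0\sim\mu_0^{(n)}$, a probability measure on $\Delta_{N-1}(n)$. At each time step $k$ an ordered pair $(i,j)$, $i\neq j$, is chosen uniformly at random among the $N(N-1)$ ordered pairs, independently of everything else. If $\mathbf{Y}^{(n)}_k=(y_1,\dots,y_N)$, then $\mathbf{Y}^{(n)}_{k+1}$ is obtained by replacing $y_i$ by $y_i'=[U^{(n)}_{i,j}(k)(y_i+y_j)]_n$ and $y_j$ by $y_i+y_j-y_i'$, all other coordinates being unchanged. Continuous-space process: $\mathbf{X}^{(\infty)}_0\sim\mu_0^{(\infty)}$, a probability measure on $\Delta_{N-1}$. At each time step $k$ an ordered pair $(i,j)$, $i\ne j$, is chosen uniformly at random, independently of everything else. If $\mathbf{X}^{(\infty)}_k=(x_1,\dots,x_N)$, then $\mathbf{X}^{(\infty)}_{k+1}$ is obtained by replacing $x_i$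 by $U^{(\infty)}_{i,j}(k)(x_i+x_j)$ and $x_j$ by $(1-U^{(\infty)}_{i,j}(k))(x_i+x_j)$, all other coordinates being unchanged. *)

theory Defs
  imports "HOL-Probability.Probability"
begin

subsection \<open>Weak convergence of probability measures on a topological space\<close>

definition borel_of :: "'a topology \<Rightarrow> 'a measure" where
  "borel_of T = sigma (topspace T) {S. openin T S}"

definition borel_prob_on :: "'a topology \<Rightarrow> 'a measure \<Rightarrow> bool" where
  "borel_prob_on T \<mu> \<longleftrightarrow> prob_space \<mu> \<and> sets \<mu> = sets (borel_of T)"

text \<open>The first conjunct is only asked for large \<open>n\<close>, so that families of laws
  indexed by \<open>n \<ge> 1\<close> are covered whatever the value at \<open>n = 0\<close> is.\<close>

definition weakly_converges_on ::
  "'a topology \<Rightarrow> (nat \<Rightarrow> 'a measure) \<Rightarrow> 'a measure \<Rightarrow> bool" where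
  "weakly_converges_on T \<mu> \<nu> \<longleftrightarrow>
     (\<forall>\<^sub>F n in sequentially. borel_prob_on T (\<mu> n)) \<and> borel_prob_on T \<nu> \<and>
     (\<forall>f. continuous_map T euclideanreal f \<and> bounded (f ` topspace T) \<longrightarrow>
        (\<lambda>n. \<integral>x. f x \<partial>\<mu> n) \<longlonglongrightarrow> (\<integral>x. f x \<partial>\<nu>))"


subsection \<open>State space and path space\<close>

text \<open>The \<open>N\<close> coordinates are indexed by a finite type, \<open>N = CARD('n)\<close>.\<close>

definition prob_simplex :: "(real ^ 'n) set" where
  "prob_simplex = {x. (\<forall>i. 0 \<le> x $ i) \<and> (\<Sum>i\<in>UNIV. x $ i) = 1}"

definition prob_simplex_grid :: "nat \<Rightarrow> (real ^ 'n) set" where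
  "prob_simplex_grid n =
     {q. (\<forall>i. 0 \<le> q $ i \<and> q $ i \<le> 1) \<and> (\<Sum>i\<in>UNIV. q $ i) = 1 \<and> (\<forall>i. real n * q $ i \<in> \<nat>)}"

definition simplex_topology :: "(real ^ 'n) topology" where
  "simplex_topology = top_of_set prob_simplex"

definition path_topology :: "(nat \<Rightarrow> real ^ 'n) topology" where
  "path_topology = product_topology (\<lambda>_. simplex_topology) UNIV"

definition path_law :: "'a measure \<Rightarrow> (nat \<Rightarrow> 'a \<Rightarrow> real ^ 'n) \<Rightarrow> (nat \<Rightarrow> real ^ 'n) measure" where
  "path_law M Y = distr M (borel_of path_topology) (\<lambda>\<omega> k. Y k \<omega>)"


subsection \<open>The driving noise\<close>

definition ordered_pairs :: "('n \<times> 'n) set" where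
  "ordered_pairs = {(i, j). i \<noteq> j}"

definition uniforms_topology :: "(('n \<times> 'n) \<times> nat \<Rightarrow> real) topology" where
  "uniforms_topology = product_topology (\<lambda>_. top_of_set {0..1}) (ordered_pairs \<times> UNIV)"

definition uniforms_law ::
  "'a measure \<Rightarrow> ('n \<times> 'n \<Rightarrow> nat \<Rightarrow> 'a \<Rightarrow> real) \<Rightarrow> (('n \<times> 'n) \<times> nat \<Rightarrow> real) measure" where
  "uniforms_law M U = distr M (borel_of uniforms_topology)
     (\<lambda>\<omega>. \<lambda>(p, k)\<in>ordered_pairs \<times> UNIV. U p k \<omega>)"

text \<open>The sources of randomness take values in different spaces, so their joint independence is
  stated for the \<open>\<sigma>\<close>-algebras they generate, indexed by the following type.\<close>

datatype 'n source = Init | Unif "'n \<times> 'n" nat | Choice nat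

definition sources :: "'n source set" where
  "sources = {Init} \<union> {Unif p k | p k. p \<in> ordered_pairs} \<union> range Choice"

primrec source_events ::
  "'a measure \<Rightarrow> ('a \<Rightarrow> real ^ 'n) \<Rightarrow> ('n \<times> 'n \<Rightarrow> nat \<Rightarrow> 'a \<Rightarrow> real) \<Rightarrow> (nat \<Rightarrow> 'a \<Rightarrow> 'n \<times> 'n) \<Rightarrow>
   'n source \<Rightarrow> 'a set set" where
  "source_events M Z U C Init = sets (vimage_algebra (space M) Z (borel_of simplex_topology))"
| "source_events M Z U C (Unif p k) =
     sets (vimage_algebra (space M) (U p k) (borel_of (top_of_set {0..1})))"
| "source_events M Z U C (Choice k) =
     sets (vimage_algebra (space M) (C k) (count_space ordered_pairs))"

text \<open>\<open>Z\<close> is the initial state, \<open>U (i, j) k\<close> the uniform variable attached to the ordered pair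
  \<open>(i, j)\<close> at step \<open>k\<close>, and \<open>C k\<close> the ordered pair chosen at step \<open>k\<close>.\<close>

definition exchange_noise ::
  "'a measure \<Rightarrow> (real ^ 'n) measure \<Rightarrow> ('a \<Rightarrow> real ^ 'n) \<Rightarrow>
   ('n \<times> 'n \<Rightarrow> nat \<Rightarrow> 'a \<Rightarrow> real) \<Rightarrow> (nat \<Rightarrow> 'a \<Rightarrow> 'n \<times> 'n) \<Rightarrow> bool" where
  "exchange_noise M \<mu> Z U C \<longleftrightarrow>
     prob_space M \<and>
     Z \<in> M \<rightarrow>\<^sub>M borel_of simplex_topology \<and> distr M (borel_of simplex_topology) Z = \<mu> \<and>
     (\<forall>p\<in>ordered_pairs. \<forall>k. U p k \<in> M \<rightarrow>\<^sub>M borel_of (top_of_set {0..1}) \<and>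
        distr M lborel (U p k) = uniform_measure lborel {0..1}) \<and>
     (\<forall>k. C k \<in> M \<rightarrow>\<^sub>M count_space ordered_pairs \<and>
        distr M (count_space ordered_pairs) (C k) = uniform_count_measure ordered_pairs) \<and>
     prob_space.indep_sets M (source_events M Z U C) sources"


subsection \<open>The exchange processes\<close>

definition grid_floor :: "nat \<Rightarrow> real \<Rightarrow> real" where
  "grid_floor n x = real (nat \<lfloor>real n * x\<rfloor>) / real n"

lemma grid_floor_eq_iff:
  fixes a :: nat
  assumes "n \<ge> 1" "x \<ge> 0"
  shows "grid_floor n x = real a / real n \<longleftrightarrow> real a / real n \<le> x \<and> x < (real a + 1) / real n"
proof -
  have "grid_floor n x = real a / real n \<longleftrightarrow> \<lfloor>real n * x\<rfloor> = int a"
    using assms by (auto simp: grid_floor_def field_simps nat_eq_iff)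
  also have "\<dots> \<longleftrightarrow> real a / real n \<le> x \<and> x < (real a + 1) / real n"
    using assms by (auto simp: floor_eq_iff field_simps)
  finally show ?thesis .
qed

definition discrete_step :: "nat \<Rightarrow> 'n \<times> 'n \<Rightarrow> real \<Rightarrow> real ^ 'n \<Rightarrow> real ^ 'n" where
  "discrete_step n p u y = (case p of (i, j) \<Rightarrow>
     let y' = grid_floor n (u * (y $ i + y $ j)) in
     (\<chi> l. if l = i then y' else if l = j then y $ i + y $ j - y' else y $ l))"

definition continuous_step :: "'n \<times> 'n \<Rightarrow> real \<Rightarrow> real ^ 'n \<Rightarrow> real ^ 'n" where
  "continuous_step p u x = (case p of (i, j) \<Rightarrow>
     (\<chi> l. if l = i then u * (x $ i + x $ j)
          else if l = j then (1 - u) * (x $ i + x $ j) else x $ l))"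

definition discrete_exchange_process ::
  "nat \<Rightarrow> 'a measure \<Rightarrow> (real ^ 'n) measure \<Rightarrow> ('n \<times> 'n \<Rightarrow> nat \<Rightarrow> 'a \<Rightarrow> real) \<Rightarrow>
   (nat \<Rightarrow> 'a \<Rightarrow> 'n \<times> 'n) \<Rightarrow> (nat \<Rightarrow> 'a \<Rightarrow> real ^ 'n) \<Rightarrow> bool" where
  "discrete_exchange_process n M \<mu> U C Y \<longleftrightarrow>
     exchange_noise M \<mu> (Y 0) U C \<and>
     (\<forall>k. \<forall>\<omega>\<in>space M. Y (Suc k) \<omega> = discrete_step n (C k \<omega>) (U (C k \<omega>) k \<omega>) (Y k \<omega>))"

definition continuous_exchange_process ::
  "'a measure \<Rightarrow> (real ^ 'n) measure \<Rightarrow> ('n \<times> 'n \<Rightarrow> nat \<Rightarrow> 'a \<Rightarrow> real) \<Rightarrow>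
   (nat \<Rightarrow> 'a \<Rightarrow> 'n \<times> 'n) \<Rightarrow> (nat \<Rightarrow> 'a \<Rightarrow> real ^ 'n) \<Rightarrow> bool" where
  "continuous_exchange_process M \<mu> U C X \<longleftrightarrow>
     exchange_noise M \<mu> (X 0) U C \<and>
     (\<forall>k. \<forall>\<omega>\<in>space M. X (Suc k) \<omega> = continuous_step (C k \<omega>) (U (C k \<omega>) k \<omega>) (X k \<omega>))"

end

theory Submission
  imports Defs
begin

text \<open>The discrete and the continuous process can be driven by the same noise. Feed the initial state
  and the noise of the \<open>n\<close>-th discrete process into the continuous dynamics; the result is called
  the driven flow. Both steps act on two coordinates by redistributing their sum, and a continuous
  step does not increase the \<open>\<ell>\<^sup>1\<close> distance of two states, because it splits the difference of the two sums in
  the proportions \<open>u\<close> and \<open>1 - u\<close>. The rounding costs at most \<open>1 / n\<close> in each of the two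
  coordinates, so by induction the discrete process at time \<open>k\<close> and the driven flow differ by at
  most \<open>2 * k / n\<close>, uniformly in the noise and in the initial state
  (\<open>discrete_path_near_exchange_flow\<close>).

  A continuous functional \<open>f\<close> on path space is uniformly continuous, since path space is a product
  of compact simplices and hence compact. So the mean of \<open>f\<close> under the discrete process and its mean
  under the driven flow on the same probability space have a difference that tends to zero
  (\<open>path_functional_uniformly_continuous\<close>).

  The mean under the driven flow only depends on the law of the initial state. Indeed the initial
  state is independent of the remaining sources, and those have the same joint law on every
  probability space, namely the product of the prescribed marginals. By Fubini the mean is
  \<open>\<integral> h d\<mu>\<^sub>n\<close>, where \<open>h z\<close> is the mean of \<open>f\<close> under the flow started at \<open>z\<close>
  (\<open>expectation_by_conditioning_on_initial_state\<close>); the limit process has the mean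
  \<open>\<integral> h d\<mu>\<close>. Since the flow does not increase distances, the function \<open>h\<close> is continuous
  (\<open>expected_flow_continuous\<close>), so the weak convergence of the initial laws gives the result.\<close>

section \<open>Compactness of path space\<close>

text \<open>The set of simplex-valued paths, so that the path topology becomes a subspace of the metric
  space of all functions \<open>nat \<Rightarrow> real ^ 'n\<close> and metric facts about compactness apply to it.\<close>

definition path_space :: "(nat \<Rightarrow> real ^ 'n) set" where
  "path_space = (\<Pi>\<^sub>E k\<in>UNIV. prob_simplex)"

definition l1_dist :: "real ^ 'n \<Rightarrow> real ^ 'n \<Rightarrow> real" where
  "l1_dist x y = (\<Sum>i\<in>UNIV. \<bar>x $ i - y $ i\<bar>)"

lemma path_space_iff: "x \<in> path_space \<longleftrightarrow> (\<forall>k. x k \<in> prob_simplex)"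
  by (simp add: path_space_def PiE_UNIV_domain Pi_iff)

lemma path_topology_eq: "path_topology = top_of_set path_space"
  unfolding path_topology_def simplex_topology_def path_space_def
  by (simp add: subtopology_product_topology[symmetric] euclidean_product_topology)

lemma compact_prob_simplex: "compact (prob_simplex :: (real ^ 'n) set)"
proof (rule compact_eq_bounded_closed[THEN iffD2], intro conjI)
  have "norm x \<le> 1" if "x \<in> prob_simplex" for x :: "real ^ 'n"
    using norm_le_l1_cart[of x] that by (simp add: prob_simplex_def)
  then show "bounded (prob_simplex :: (real ^ 'n) set)"
    by (auto simp: bounded_iff)
  have "closed {x :: real ^ 'n. 0 \<le> x $ i}" for i
    by (intro closed_Collect_le continuous_intros)
  moreover have "closed {x :: real ^ 'n. (\<Sum>i\<in>UNIV. x $ i) = 1}"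
    by (intro closed_Collect_eq continuous_intros)
  ultimately show "closed (prob_simplex :: (real ^ 'n) set)"
    by (simp add: prob_simplex_def closed_Collect_conj closed_Collect_all)
qed

text \<open>Tychonoff's theorem.\<close>

lemma compact_path_space: "compact (path_space :: (nat \<Rightarrow> real ^ 'n) set)"
proof -
  have "compactin (product_topology (\<lambda>_. euclidean) UNIV) (path_space :: (nat \<Rightarrow> real ^ 'n) set)"
    unfolding path_space_def compactin_PiE by (simp add: compact_prob_simplex)
  then show ?thesis
    by (simp add: euclidean_product_topology)
qed

text \<open>The metric on sequences weights the coordinates geometrically, so closeness at finitely many
  times suffices: the first coordinates contribute at most twice their largest distance, the tail
  at most \<open>(1/2) ^ N\<close>.\<close>

lemma dist_fun_less_if_finitely_many_close:
  fixes e :: real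
  assumes "e > 0"
  obtains K where "\<And>x y :: nat \<Rightarrow> 'm::metric_space.
    (\<And>k. k \<le> K \<Longrightarrow> dist (x k) (y k) < e / 4) \<Longrightarrow> dist x y < e"
proof -
  obtain N where N: "(1/2::real) ^ N < e / 2"
    using real_arch_pow_inv[of "e / 2" "1/2"] assms by auto
  define K where "K = Max ((from_nat :: nat \<Rightarrow> nat) ` {..N})"
  have "dist x y < e" if close: "\<And>k. k \<le> K \<Longrightarrow> dist (x k) (y k) < e / 4" for x y :: "nat \<Rightarrow> 'm"
  proof -
    let ?D = "{dist (x (from_nat n)) (y (from_nat n)) |n. n \<le> N}"
    have D: "?D = (\<lambda>n. dist (x (from_nat n)) (y (from_nat n))) ` {..N}" by auto
    have "from_nat n \<le> K" if "n \<le> N" for n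
      using that by (auto simp: K_def intro!: Max_ge)
    then have "Max ?D < e / 4"
      unfolding D by (subst Max_less_iff) (auto simp del: less_divide_eq_numeral1 intro!: close)
    then show ?thesis
      using dist_fun_le_dist_first_terms[of x y N] N by linarith
  qed
  then show ?thesis using that by blast
qed

text \<open>Heine's theorem on the compact path space, with the modulus of continuity expressed by the
  \<open>\<ell>\<^sup>1\<close> distances at finitely many times, which is what the comparison of the dynamics controls.\<close>

lemma path_functional_uniformly_continuous:
  fixes f :: "(nat \<Rightarrow> real ^ 'n) \<Rightarrow> real"
  assumes f: "continuous_on path_space f" and e: "e > 0"
  obtains K d where "d > 0" "\<And>x y. x \<in> path_space \<Longrightarrow> y \<in> path_space \<Longrightarrow>
    (\<And>k. k \<le> K \<Longrightarrow> l1_dist (x k) (y k) < d) \<Longrightarrow> \<bar>f x - f y\<bar> < e"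
proof -
  have "uniformly_continuous_on path_space f"
    by (rule compact_uniformly_continuous[OF f compact_path_space])
  then obtain d where d: "d > 0"
    "\<And>x y. x \<in> path_space \<Longrightarrow> y \<in> path_space \<Longrightarrow> dist x y < d \<Longrightarrow> dist (f x) (f y) < e"
    unfolding uniformly_continuous_on_def using e by (metis dist_commute)
  obtain K where K: "\<And>x y :: nat \<Rightarrow> real ^ 'n.
      (\<And>k. k \<le> K \<Longrightarrow> dist (x k) (y k) < d / 4) \<Longrightarrow> dist x y < d"
    using dist_fun_less_if_finitely_many_close[OF \<open>d > 0\<close>] by metis
  have "dist a b \<le> l1_dist a b" for a b :: "real ^ 'n"
    using norm_le_l1_cart[of "a - b"] by (simp add: dist_norm l1_dist_def)
  then have "dist x y < d" if "\<And>k. k \<le> K \<Longrightarrow> l1_dist (x k) (y k) < d / 4"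
    for x y :: "nat \<Rightarrow> real ^ 'n"
    using that by (intro K) (meson le_less_trans)
  then show ?thesis
    using d by (intro that[of "d / 4" K]) (auto simp: dist_real_def)
qed

section \<open>The exchange dynamics\<close>

lemma sum_split_pair:
  fixes g :: "'n::finite \<Rightarrow> real"
  assumes "i \<noteq> j"
  shows "(\<Sum>l\<in>UNIV. g l) = g i + g j + (\<Sum>l\<in>UNIV - {i, j}. g l)"
proof -
  have "(\<Sum>l\<in>UNIV. g l) = (\<Sum>l\<in>{i, j}. g l) + (\<Sum>l\<in>UNIV - {i, j}. g l)"
    by (metis finite subset_UNIV sum.subset_diff add.commute)
  then show ?thesis using assms by simp
qed

lemma exchange_in_simplex:
  assumes "i \<noteq> j" "y \<in> prob_simplex" "0 \<le> s" "s \<le> y $ i + y $ j"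
  shows "(\<chi> l. if l = i then s else if l = j then y $ i + y $ j - s else y $ l) \<in> prob_simplex"
  using assms sum_split_pair[OF \<open>i \<noteq> j\<close>, of "\<lambda>l. y $ l"]
  by (auto simp: prob_simplex_def sum_split_pair[OF \<open>i \<noteq> j\<close>])

lemma continuous_step_eq:
  "continuous_step (i, j) u x =
     (\<chi> l. if l = i then u * (x $ i + x $ j)
       else if l = j then x $ i + x $ j - u * (x $ i + x $ j) else x $ l)"
  by (simp add: continuous_step_def left_diff_distrib cong: if_cong)

lemma discrete_step_eq:
  "discrete_step n (i, j) u y =
     (\<chi> l. if l = i then grid_floor n (u * (y $ i + y $ j))
       else if l = j then y $ i + y $ j - grid_floor n (u * (y $ i + y $ j)) else y $ l)"
  by (simp add: discrete_step_def Let_def)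

lemma continuous_step_in_simplex:
  assumes "p \<in> ordered_pairs" "u \<in> {0..1}" "x \<in> prob_simplex"
  shows "continuous_step p u x \<in> prob_simplex"
proof -
  obtain i j where p: "p = (i, j)" "i \<noteq> j" using assms by (auto simp: ordered_pairs_def)
  have nonneg: "0 \<le> x $ i + x $ j" using assms by (simp add: prob_simplex_def)
  show ?thesis
    unfolding p continuous_step_eq using assms nonneg p
    by (intro exchange_in_simplex) (auto intro: mult_left_le_one_le)
qed

lemma grid_floor_bounds:
  assumes "n \<ge> 1" "0 \<le> x"
  shows "0 \<le> grid_floor n x" "grid_floor n x \<le> x" "x - grid_floor n x \<le> 1 / real n"
proof -
  define a where "a = real (nat \<lfloor>real n * x\<rfloor>)"
  have n: "real n > 0" using assms by simp
  have "a = of_int \<lfloor>real n * x\<rfloor>"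
    using assms by (simp add: a_def)
  then have "a \<le> real n * x" "real n * x \<le> a + 1"
    by linarith+
  then have "a / real n \<le> x" "x \<le> (a + 1) / real n"
    using n by (simp_all add: divide_le_eq le_divide_eq mult.commute)
  moreover have "grid_floor n x = a / real n"
    by (simp add: grid_floor_def a_def)
  ultimately show "0 \<le> grid_floor n x" "grid_floor n x \<le> x" "x - grid_floor n x \<le> 1 / real n"
    by (auto simp: a_def add_divide_distrib)
qed

lemma discrete_step_in_simplex:
  assumes "n \<ge> 1" "p \<in> ordered_pairs" "u \<in> {0..1}" "y \<in> prob_simplex"
  shows "discrete_step n p u y \<in> prob_simplex"
proof -
  obtain i j where p: "p = (i, j)" "i \<noteq> j" using assms by (auto simp: ordered_pairs_def)
  have nonneg: "0 \<le> y $ i + y $ j" using assms by (simp add: prob_simplex_def)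
  then have s: "0 \<le> u * (y $ i + y $ j)" "u * (y $ i + y $ j) \<le> y $ i + y $ j"
    using assms by (auto intro: mult_left_le_one_le)
  show ?thesis
    unfolding p discrete_step_eq
    using grid_floor_bounds[OF \<open>n \<ge> 1\<close> s(1)] s assms p
    by (intro exchange_in_simplex) auto
qed

lemma l1_dist_triangle: "l1_dist x z \<le> l1_dist x y + l1_dist y z"
  unfolding l1_dist_def sum.distrib[symmetric] by (intro sum_mono) linarith

text \<open>The two coordinates of the new states differ by the shares \<open>u\<close> and \<open>1 - u\<close> of the
  difference of the two pair sums, hence together by at most the old difference.\<close>

lemma continuous_step_nonexpansive:
  assumes "p \<in> ordered_pairs" "u \<in> {0..1}"
  shows "l1_dist (continuous_step p u x) (continuous_step p u y) \<le> l1_dist x y"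
proof -
  obtain i j where p: "p = (i, j)" "i \<noteq> j" using assms by (auto simp: ordered_pairs_def)
  let ?d = "(x $ i + x $ j) - (y $ i + y $ j)"
  have "\<bar>u * (x $ i + x $ j) - u * (y $ i + y $ j)\<bar> = u * \<bar>?d\<bar>"
    using assms by (simp add: right_diff_distrib[symmetric] abs_mult)
  moreover have "\<bar>(1 - u) * (x $ i + x $ j) - (1 - u) * (y $ i + y $ j)\<bar> = (1 - u) * \<bar>?d\<bar>"
    using assms by (simp add: right_diff_distrib[symmetric] abs_mult)
  ultimately have "\<bar>u * (x $ i + x $ j) - u * (y $ i + y $ j)\<bar>
      + \<bar>(1 - u) * (x $ i + x $ j) - (1 - u) * (y $ i + y $ j)\<bar>
      \<le> \<bar>x $ i - y $ i\<bar> + \<bar>x $ j - y $ j\<bar>"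
    by (simp add: distrib_right[symmetric] left_diff_distrib)
  then show ?thesis
    using p(2) by (simp add: p(1) l1_dist_def continuous_step_def sum_split_pair[OF p(2)])
qed

text \<open>Rounding shifts at most \<open>1 / n\<close> from one coordinate of the pair to the other.\<close>

lemma discrete_step_near_continuous_step:
  assumes "n \<ge> 1" "p \<in> ordered_pairs" "u \<in> {0..1}" "y \<in> prob_simplex"
  shows "l1_dist (discrete_step n p u y) (continuous_step p u y) \<le> 2 / real n"
proof -
  obtain i j where p: "p = (i, j)" "i \<noteq> j" using assms by (auto simp: ordered_pairs_def)
  have s: "0 \<le> u * (y $ i + y $ j)" using assms by (simp add: prob_simplex_def)
  show ?thesis
    using grid_floor_bounds[OF \<open>n \<ge> 1\<close> s] p(2)
    by (simp add: p(1) l1_dist_def continuous_step_eq discrete_step_eq sum_split_pair[OF p(2)])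
qed

text \<open>The continuous dynamics as a deterministic map of the chosen pairs, the splitting ratios and
  the initial state. It serves to run the continuous process on the noise of a discrete one.\<close>

primrec exchange_flow :: "(nat \<Rightarrow> 'n \<times> 'n) \<Rightarrow> (nat \<Rightarrow> real) \<Rightarrow> real ^ 'n \<Rightarrow> nat \<Rightarrow> real ^ 'n" where
  "exchange_flow c u z 0 = z"
| "exchange_flow c u z (Suc k) = continuous_step (c k) (u k) (exchange_flow c u z k)"

lemma exchange_flow_in_path_space:
  assumes "\<And>k. c k \<in> ordered_pairs" "\<And>k. u k \<in> {0..1}" "z \<in> prob_simplex"
  shows "exchange_flow c u z \<in> path_space"
proof -
  have "exchange_flow c u z k \<in> prob_simplex" for k
    by (induction k) (simp_all add: assms continuous_step_in_simplex del: atLeastAtMost_iff split_paired_All)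
  then show ?thesis by (simp add: path_space_iff)
qed

lemma exchange_flow_nonexpansive:
  assumes "\<And>k. c k \<in> ordered_pairs" "\<And>k. u k \<in> {0..1}"
  shows "l1_dist (exchange_flow c u z k) (exchange_flow c u z' k) \<le> l1_dist z z'"
proof (induction k)
  case (Suc k)
  then show ?case
    using continuous_step_nonexpansive[OF assms, of k k "exchange_flow c u z k" "exchange_flow c u z' k"]
    by simp
qed simp

text \<open>Each step adds an error of \<open>2 / n\<close>, and the nonexpansive continuous steps keep the earlier
  errors from growing.\<close>

lemma discrete_path_near_exchange_flow:
  assumes "n \<ge> 1" "\<And>k. c k \<in> ordered_pairs" "\<And>k. u k \<in> {0..1}" "y 0 \<in> prob_simplex"
    and step: "\<And>k. y (Suc k) = discrete_step n (c k) (u k) (y k)"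
  shows "y \<in> path_space"
    and "l1_dist (y k) (exchange_flow c u (y 0) k) \<le> 2 * real k / real n"
proof -
  have mem: "y k \<in> prob_simplex" for k
    by (induction k) (simp_all add: assms discrete_step_in_simplex[OF assms(1)] del: atLeastAtMost_iff split_paired_All)
  then show "y \<in> path_space" by (simp add: path_space_iff)
  show "l1_dist (y k) (exchange_flow c u (y 0) k) \<le> 2 * real k / real n"
  proof (induction k)
    case 0
    then show ?case by (simp add: l1_dist_def)
  next
    case (Suc k)
    let ?x = "exchange_flow c u (y 0) k"
    have "l1_dist (y (Suc k)) (exchange_flow c u (y 0) (Suc k))
        \<le> l1_dist (discrete_step n (c k) (u k) (y k)) (continuous_step (c k) (u k) (y k))
          + l1_dist (continuous_step (c k) (u k) (y k)) (continuous_step (c k) (u k) ?x)"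
      using l1_dist_triangle by (simp add: step)
    also have "\<dots> \<le> 2 / real n + l1_dist (y k) ?x"
      using assms mem discrete_step_near_continuous_step continuous_step_nonexpansive
      by (intro add_mono) blast+
    also have "\<dots> \<le> 2 * real (Suc k) / real n"
      using Suc by (simp add: add_divide_distrib distrib_left)
    finally show ?case .
  qed
qed

section \<open>Measurability\<close>

lemma sets_borel_of: "sets (borel_of T) = sigma_sets (topspace T) {S. openin T S}"
  and space_borel_of: "space (borel_of T) = topspace T"
proof -
  have "{S. openin T S} \<subseteq> Pow (topspace T)"
    using openin_subset by blast
  then show "sets (borel_of T) = sigma_sets (topspace T) {S. openin T S}"
    unfolding borel_of_def by (rule sets_measure_of)
qed (simp add: borel_of_def space_measure_of_conv)

lemma borel_measurable_of_continuous_map: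
  fixes f :: "'a \<Rightarrow> 'b::topological_space"
  assumes "continuous_map T euclidean f"
  shows "f \<in> borel_measurable (borel_of T)"
proof (rule borel_measurableI)
  fix S :: "'b set" assume "open S"
  then have "openin T {x \<in> topspace T. f x \<in> S}"
    by (intro openin_continuous_map_preimage[OF assms]) simp
  then show "f -` S \<inter> space (borel_of T) \<in> sets (borel_of T)"
    unfolding sets_borel_of space_borel_of
    by (auto simp: vimage_def Int_def conj_commute intro!: sigma_sets.Basic)
qed

lemma measurable_into_borel_of_subset:
  assumes "X \<in> borel_measurable M" "\<And>\<omega>. \<omega> \<in> space M \<Longrightarrow> X \<omega> \<in> S"
  shows "X \<in> M \<rightarrow>\<^sub>M borel_of (top_of_set S)"
  unfolding borel_of_def
proof (rule measurable_measure_of)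
  fix A assume "A \<in> {A. openin (top_of_set S) A}"
  then obtain B where B: "open B" "A = S \<inter> B" by (auto simp: openin_open)
  then have "X -` A \<inter> space M = X -` B \<inter> space M" using assms(2) by auto
  then show "X -` A \<inter> space M \<in> sets M"
    using B(1) assms(1) by (simp add: measurable_sets)
qed (use assms(2) openin_subset in fastforce)+

lemma measurable_from_borel_of_subset:
  assumes "X \<in> M \<rightarrow>\<^sub>M borel_of (top_of_set S)"
  shows "X \<in> borel_measurable M" "\<And>\<omega>. \<omega> \<in> space M \<Longrightarrow> X \<omega> \<in> S"
proof -
  have "(\<lambda>x. x) \<in> borel_measurable (borel_of (top_of_set S))"
    by (rule borel_measurable_of_continuous_map) simp
  from measurable_compose[OF assms this] show "X \<in> borel_measurable M" .
  show "X \<omega> \<in> S" if "\<omega> \<in> space M" for \<omega>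
    using measurable_space[OF assms that] by (simp add: space_borel_of)
qed

lemma measurable_vec_nth [measurable]:
  "(\<lambda>x. x $ i) \<in> borel_measurable (borel :: (real ^ 'n) measure)"
  by (intro borel_measurable_continuous_onI continuous_intros)

lemma measurable_vec_lambda:
  assumes "\<And>i. (\<lambda>x. f x i) \<in> borel_measurable M"
  shows "(\<lambda>x. (\<chi> i. f x i) :: real ^ 'n) \<in> borel_measurable M"
  using assms by (subst borel_measurable_euclidean_space) (auto simp: Basis_vec_def inner_axis)

lemma continuous_step_measurable:
  fixes p :: "'n::finite \<times> 'n"
  shows "(\<lambda>(u, x). continuous_step p u x) \<in> borel_measurable (borel \<Otimes>\<^sub>M borel)"
proof -
  have "(\<lambda>v. continuous_step (i, j) (fst v) (snd v)) \<in> borel_measurable (borel \<Otimes>\<^sub>M borel)" for i j :: "'n::finite"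
    unfolding continuous_step_def prod.case
    by (rule measurable_vec_lambda) measurable
  then show ?thesis by (cases p) (simp add: case_prod_beta')
qed

lemma discrete_step_measurable:
  fixes p :: "'n::finite \<times> 'n"
  shows "(\<lambda>(u, x). discrete_step n p u x) \<in> borel_measurable (borel \<Otimes>\<^sub>M borel)"
proof -
  have "(\<lambda>v. discrete_step n (i, j) (fst v) (snd v)) \<in> borel_measurable (borel \<Otimes>\<^sub>M borel)" for i j :: "'n::finite"
    unfolding discrete_step_eq grid_floor_def
    by (rule measurable_vec_lambda) measurable
  then show ?thesis by (cases p) (simp add: case_prod_beta')
qed

text \<open>The splitting variable used at time \<open>k\<close> has a random index, namely the chosen pair. As
  there are only finitely many pairs, measurability of a step can be checked for each fixed pair;
  and since time is countable, measurability at each time gives measurability of the path.\<close>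

lemma driven_process_measurable:
  fixes C :: "nat \<Rightarrow> 'a \<Rightarrow> 'n::finite \<times> 'n" and Y :: "nat \<Rightarrow> 'a \<Rightarrow> real ^ 'n"
  assumes step: "\<And>p. (\<lambda>(u, x). step p u x) \<in> borel_measurable (borel \<Otimes>\<^sub>M borel)"
    and C: "\<And>k. C k \<in> M \<rightarrow>\<^sub>M count_space ordered_pairs"
    and U: "\<And>p k. p \<in> ordered_pairs \<Longrightarrow> U p k \<in> borel_measurable M"
    and init: "Y 0 \<in> borel_measurable M"
    and rec: "\<And>k \<omega>. \<omega> \<in> space M \<Longrightarrow> Y (Suc k) \<omega> = step (C k \<omega>) (U (C k \<omega>) k \<omega>) (Y k \<omega>)"
  shows "(\<lambda>\<omega> k. Y k \<omega>) \<in> borel_measurable M"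
proof (rule measurable_coordinatewise_then_product)
  show "(\<lambda>\<omega>. Y k \<omega>) \<in> borel_measurable M" for k
  proof (induction k)
    case (Suc k)
    have "(\<lambda>\<omega>. step p (U p k \<omega>) (Y k \<omega>)) \<in> borel_measurable M" if "p \<in> ordered_pairs" for p
      using measurable_compose[OF measurable_Pair[OF U[OF that] Suc] step[of p]]
      unfolding prod.case .
    then have "(\<lambda>\<omega>. step (C k \<omega>) (U (C k \<omega>) k \<omega>) (Y k \<omega>)) \<in> borel_measurable M"
      by (rule measurable_compose_countable'[OF _ C[of k] countableI_type])
    then show ?case
      by (rule measurable_cong[THEN iffD2, rotated]) (rule rec)
  qed (rule init)
qed

text \<open>The noise variables take values in subspaces. Measurability into the ambient Borel spaces is stated
  along with the pointwise membership, since the calculations run in the ambient types.\<close>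

lemma
  assumes "exchange_noise M \<mu> Z U C"
  shows noise_prob_space: "prob_space M"
    and noise_init_measurable: "Z \<in> borel_measurable M"
    and noise_init_in_simplex: "\<And>\<omega>. \<omega> \<in> space M \<Longrightarrow> Z \<omega> \<in> prob_simplex"
    and noise_init_law: "\<mu> = distr M (borel_of simplex_topology) Z"
    and noise_init_borel_of: "Z \<in> M \<rightarrow>\<^sub>M borel_of simplex_topology"
    and noise_uniform_measurable: "\<And>p k. p \<in> ordered_pairs \<Longrightarrow> U p k \<in> borel_measurable M"
    and noise_uniform_borel_of: "\<And>p k. p \<in> ordered_pairs \<Longrightarrow> U p k \<in> M \<rightarrow>\<^sub>M borel_of (top_of_set {0..1})"
    and noise_uniform_law: "\<And>p k. p \<in> ordered_pairs \<Longrightarrow> distr M lborel (U p k) = uniform_measure lborel {0..1}"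
    and noise_choice_measurable: "\<And>k. C k \<in> M \<rightarrow>\<^sub>M count_space ordered_pairs"
    and noise_choice_law: "\<And>k. distr M (count_space ordered_pairs) (C k) = uniform_count_measure ordered_pairs"
    and noise_choice_in_pairs: "\<And>\<omega> k. \<omega> \<in> space M \<Longrightarrow> C k \<omega> \<in> ordered_pairs"
    and noise_uniform_in_unit_interval: "\<And>\<omega> k. \<omega> \<in> space M \<Longrightarrow> U (C k \<omega>) k \<omega> \<in> {0..1}"
    and noise_independent: "prob_space.indep_sets M (source_events M Z U C) sources"
proof -
  have unif: "\<forall>p\<in>ordered_pairs. \<forall>k. U p k \<in> M \<rightarrow>\<^sub>M borel_of (top_of_set {0..1}) \<and>
      distr M lborel (U p k) = uniform_measure lborel {0..1}"
    and choice: "\<forall>k. C k \<in> M \<rightarrow>\<^sub>M count_space ordered_pairs \<and>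
      distr M (count_space ordered_pairs) (C k) = uniform_count_measure ordered_pairs"
    and Z: "Z \<in> M \<rightarrow>\<^sub>M borel_of simplex_topology"
    and law: "distr M (borel_of simplex_topology) Z = \<mu>"
    and rest: "prob_space M" "prob_space.indep_sets M (source_events M Z U C) sources"
    using assms unfolding exchange_noise_def by - (elim conjE, assumption)+
  show "prob_space M" "prob_space.indep_sets M (source_events M Z U C) sources"
    by (rule rest)+
  show "\<mu> = distr M (borel_of simplex_topology) Z" by (rule law[symmetric])
  show "Z \<in> M \<rightarrow>\<^sub>M borel_of simplex_topology" by (rule Z)
  show C: "\<And>k. C k \<in> M \<rightarrow>\<^sub>M count_space ordered_pairs"
    and "\<And>k. distr M (count_space ordered_pairs) (C k) = uniform_count_measure ordered_pairs"
    using choice by iprover+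
  show U: "\<And>p k. p \<in> ordered_pairs \<Longrightarrow> U p k \<in> M \<rightarrow>\<^sub>M borel_of (top_of_set {0..1})"
    and "\<And>p k. p \<in> ordered_pairs \<Longrightarrow> distr M lborel (U p k) = uniform_measure lborel {0..1}"
    using unif by (iprover dest: bspec)+
  show "Z \<in> borel_measurable M" "\<And>\<omega>. \<omega> \<in> space M \<Longrightarrow> Z \<omega> \<in> prob_simplex"
    using measurable_from_borel_of_subset[OF Z[unfolded simplex_topology_def]] by auto
  show "\<And>p k. p \<in> ordered_pairs \<Longrightarrow> U p k \<in> borel_measurable M"
    using measurable_from_borel_of_subset(1)[OF U] .
  show Cin: "C k \<omega> \<in> ordered_pairs" if "\<omega> \<in> space M" for k \<omega>
    using measurable_space[OF C that] by simp
  show "U (C k \<omega>) k \<omega> \<in> {0..1}" if "\<omega> \<in> space M" for k \<omega>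
    using measurable_from_borel_of_subset(2)[OF U[OF Cin[OF that]] that] .
qed

section \<open>The joint law of the noise\<close>

definition driving_sources :: "'n source set" where
  "driving_sources = sources - {Init}"

text \<open>A filler for the slots of a source value that its source does not use.\<close>

definition some_pair :: "'n \<times> 'n" where
  "some_pair = (SOME p. p \<in> ordered_pairs)"

text \<open>Families of independent random variables and product measures have members with one common
  value type. Hence each source is embedded into the triples of a state, a real number and a
  pair, with fixed entries in the two slots that do not belong to it. The embedding creates no
  events beyond those of the source.\<close>

primrec source_value ::
  "('a \<Rightarrow> real ^ 'n) \<Rightarrow> ('n \<times> 'n \<Rightarrow> nat \<Rightarrow> 'a \<Rightarrow> real) \<Rightarrow> (nat \<Rightarrow> 'a \<Rightarrow> 'n \<times> 'n) \<Rightarrow>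
   'n source \<Rightarrow> 'a \<Rightarrow> (real ^ 'n) \<times> real \<times> ('n \<times> 'n)" where
  "source_value Z U C Init = (\<lambda>\<omega>. (Z \<omega>, 0, some_pair))"
| "source_value Z U C (Unif p k) = (\<lambda>\<omega>. (0, U p k \<omega>, some_pair))"
| "source_value Z U C (Choice k) = (\<lambda>\<omega>. (0, 0, C k \<omega>))"

abbreviation value_algebra :: "((real ^ 'n) \<times> real \<times> ('n \<times> 'n)) measure" where
  "value_algebra \<equiv> borel \<Otimes>\<^sub>M (borel \<Otimes>\<^sub>M count_space ordered_pairs)"

text \<open>The sources other than the initial state as one random element. The argument for the initial
  state is a dummy, as the source \<open>Init\<close> does not occur among the indices.\<close>

abbreviation driving_values ::
  "('n \<times> 'n \<Rightarrow> nat \<Rightarrow> 'a \<Rightarrow> real) \<Rightarrow> (nat \<Rightarrow> 'a \<Rightarrow> 'n \<times> 'n) \<Rightarrow>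
   'a \<Rightarrow> 'n source \<Rightarrow> (real ^ 'n) \<times> real \<times> ('n \<times> 'n)" where
  "driving_values U C \<equiv> \<lambda>\<omega>. \<lambda>s\<in>driving_sources. source_value (\<lambda>_. 0) U C s \<omega>"

abbreviation driving_algebra ::
  "('n source \<Rightarrow> (real ^ 'n) \<times> real \<times> ('n \<times> 'n)) measure" where
  "driving_algebra \<equiv> PiM driving_sources (\<lambda>_. value_algebra)"

lemma driving_sources_iff:
  "Unif p k \<in> driving_sources \<longleftrightarrow> p \<in> ordered_pairs" "Choice k \<in> driving_sources"
  "Init \<notin> driving_sources"
  by (cases p) (auto simp: driving_sources_def sources_def)

lemma some_pair_in_ordered_pairs:
  fixes Z :: "'a \<Rightarrow> real ^ 'n"
  assumes "exchange_noise M \<mu> Z U C"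
  shows "some_pair \<in> (ordered_pairs :: ('n \<times> 'n) set)"
proof -
  obtain \<omega> where "\<omega> \<in> space M"
    using prob_space.not_empty[OF noise_prob_space[OF assms]] by blast
  then have "C 0 \<omega> \<in> ordered_pairs"
    by (rule noise_choice_in_pairs[OF assms])
  then show ?thesis
    unfolding some_pair_def by (rule someI)
qed

lemma sets_sigma_sets:
  assumes "space V = S"
  shows "sets (sigma S (sets V)) = sets V"
  using sets_measure_of[OF sets.space_closed[of V]] sets.sigma_sets_eq[of V] assms by simp

lemma source_events_closed:
  "sets (sigma (space M) (source_events M Z U C s)) = source_events M Z U C s"
  by (cases s) (simp_all only: source_events.simps sets_sigma_sets space_vimage_algebra)

text \<open>An embedded source is measurable with respect to the events of this source alone, which is what
  transfers independence from the event families to the embedded variables.\<close>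

lemma source_value_measurable:
  fixes Z :: "'a \<Rightarrow> real ^ 'n"
  assumes noise: "exchange_noise M \<mu> Z U C" and "s \<in> sources"
  shows "source_value Z U C s
    \<in> sigma (space M) (source_events M Z U C s) \<rightarrow>\<^sub>M value_algebra"
proof -
  have "some_pair \<in> space (count_space (ordered_pairs :: ('n \<times> 'n) set))"
    using some_pair_in_ordered_pairs[OF noise] by simp
  then have const: "(\<lambda>_. some_pair :: 'n \<times> 'n) \<in> L \<rightarrow>\<^sub>M count_space ordered_pairs" for L :: "'a measure"
    by (rule measurable_const)
  have gen: "f \<in> sigma (space M) (sets (vimage_algebra (space M) f N)) \<rightarrow>\<^sub>M N"
    if f: "f \<in> M \<rightarrow>\<^sub>M N" for f and N :: "'z measure"
  proof -
    have "f \<in> space M \<rightarrow> space N" using measurable_space[OF f] by blast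
    then have "f \<in> vimage_algebra (space M) f N \<rightarrow>\<^sub>M N" by (rule measurable_vimage_algebra1)
    moreover have eq: "sets (sigma (space M) (sets (vimage_algebra (space M) f N)))
        = sets (vimage_algebra (space M) f N)"
      by (rule sets_sigma_sets) simp
    ultimately show ?thesis by (subst measurable_cong_sets[OF eq refl])
  qed
  show ?thesis
  proof (cases s)
    case Init
    have "Z \<in> sigma (space M) (source_events M Z U C s) \<rightarrow>\<^sub>M borel_of simplex_topology"
      unfolding Init source_events.simps by (rule gen[OF noise_init_borel_of[OF noise]])
    then have "Z \<in> borel_measurable (sigma (space M) (source_events M Z U C s))"
      unfolding simplex_topology_def by (rule measurable_from_borel_of_subset)
    then show ?thesis
      unfolding Init source_value.simps by (intro measurable_Pair const borel_measurable_const)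
  next
    case (Unif p k)
    then have p: "p \<in> ordered_pairs" using \<open>s \<in> sources\<close> by (auto simp: sources_def)
    have "U p k \<in> sigma (space M) (source_events M Z U C s) \<rightarrow>\<^sub>M borel_of (top_of_set {0..1})"
      unfolding Unif source_events.simps by (rule gen[OF noise_uniform_borel_of[OF noise p]])
    then have "U p k \<in> borel_measurable (sigma (space M) (source_events M Z U C s))"
      by (rule measurable_from_borel_of_subset)
    then show ?thesis
      unfolding Unif source_value.simps by (intro measurable_Pair const borel_measurable_const)
  next
    case (Choice k)
    have "C k \<in> sigma (space M) (source_events M Z U C s) \<rightarrow>\<^sub>M count_space ordered_pairs"
      unfolding Choice source_events.simps by (rule gen[OF noise_choice_measurable[OF noise]])
    then show ?thesis
      unfolding Choice source_value.simps
      by (rule measurable_Pair[OF borel_measurable_const measurable_Pair[OF borel_measurable_const]])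
  qed
qed

lemma sources_independent:
  fixes Z :: "'a \<Rightarrow> real ^ 'n"
  assumes noise: "exchange_noise M \<mu> Z U C"
  shows "prob_space.indep_vars M (\<lambda>_. value_algebra) (source_value Z U C) sources"
proof -
  interpret prob_space M by (rule noise_prob_space[OF noise])
  note indep = noise_independent[OF noise]
  have space: "space (sigma (space M) (source_events M Z U C s)) = space M" for s
    by (rule space_measure_of_conv)
  have sub: "source_value Z U C s -` A \<inter> space M \<in> source_events M Z U C s"
    if "s \<in> sources" "A \<in> sets value_algebra" for s A
    using measurable_sets[OF source_value_measurable[OF noise that(1)] that(2)]
    by (simp only: source_events_closed space)
  show ?thesis
    unfolding indep_vars_def2
  proof (intro conjI ballI)
    fix s :: "'n source" assume s: "s \<in> sources"
    have "source_events M Z U C s \<subseteq> events"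
      using indep s unfolding indep_sets_def by blast
    then have "source_value Z U C s -` A \<inter> space M \<in> events" if "A \<in> sets value_algebra" for A
      using sub[OF s that] by (rule subsetD)
    then show "source_value Z U C s \<in> M \<rightarrow>\<^sub>M value_algebra"
      using measurable_space[OF source_value_measurable[OF noise s], unfolded space]
      by (intro measurableI)
  next
    show "indep_sets (\<lambda>s. {source_value Z U C s -` A \<inter> space M |A. A \<in> sets value_algebra}) sources"
      by (rule indep_sets_mono_sets[OF indep]) (use sub in blast)
  qed
qed

text \<open>The law of each driving source is prescribed: uniform on the unit interval or uniform on the
  pairs, regardless of the underlying probability space.\<close>

lemma source_value_law_unique:
  fixes Z :: "'a \<Rightarrow> real ^ 'n" and Z' :: "'b \<Rightarrow> real ^ 'n"
  assumes noise: "exchange_noise M \<mu> Z U C" "exchange_noise M' \<mu>' Z' U' C'"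
    and s: "s \<in> driving_sources"
  shows "distr M value_algebra (source_value Z U C s) = distr M' value_algebra (source_value Z' U' C' s)"
proof -
  have "some_pair \<in> space (count_space (ordered_pairs :: ('n \<times> 'n) set))"
    using some_pair_in_ordered_pairs[OF noise(1)] by simp
  then have "(\<lambda>_. some_pair :: 'n \<times> 'n) \<in> L \<rightarrow>\<^sub>M count_space ordered_pairs" for L :: "real measure"
    by (rule measurable_const)
  then have embed_unif: "(\<lambda>u. (0, u, some_pair)) \<in> lborel \<rightarrow>\<^sub>M (value_algebra :: ((real ^ 'n) \<times> real \<times> ('n \<times> 'n)) measure)"
    by (intro measurable_Pair borel_measurable_const) simp_all
  have embed_choice: "(\<lambda>p. (0, 0, p)) \<in> count_space ordered_pairs \<rightarrow>\<^sub>M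
      (value_algebra :: ((real ^ 'n) \<times> real \<times> ('n \<times> 'n)) measure)"
    by (simp add: space_pair_measure)
  show ?thesis
  proof (cases s)
    case Init
    then show ?thesis using s by (simp add: driving_sources_iff)
  next
    case (Unif p k)
    then have p: "p \<in> ordered_pairs" using s by (simp add: driving_sources_iff)
    have "distr L value_algebra (source_value W V D s)
        = distr (uniform_measure lborel {0..1}) value_algebra (\<lambda>u. (0, u, some_pair))"
      if L: "exchange_noise L \<nu> W V D" for L :: "'z measure" and \<nu> W V D
      unfolding noise_uniform_law[OF L p, symmetric, of k]
      using noise_uniform_measurable[OF L p]
      by (subst distr_distr[OF embed_unif]) (simp_all only: measurable_lborel1 Unif o_def source_value.simps)
    then show ?thesis using noise by metis
  next
    case (Choice k)
    have "distr L value_algebra (source_value W V D s)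
        = distr (uniform_count_measure ordered_pairs) value_algebra (\<lambda>p. (0, 0, p))"
      if L: "exchange_noise L \<nu> W V D" for L \<nu> W V D
      unfolding noise_choice_law[OF L, symmetric, of k]
      by (subst distr_distr[OF embed_choice noise_choice_measurable[OF L]])
        (simp only: Choice o_def source_value.simps)
    then show ?thesis using noise by metis
  qed
qed

lemma source_value_random_variable:
  assumes noise: "exchange_noise M \<mu> Z U C" and s: "s \<in> sources"
  shows "source_value Z U C s \<in> M \<rightarrow>\<^sub>M value_algebra"
proof -
  interpret prob_space M by (rule noise_prob_space[OF noise])
  show ?thesis using sources_independent[OF noise] s unfolding indep_vars_def2 by blast
qed

lemma driving_values_eq:
  "driving_values U C = (\<lambda>\<omega>. \<lambda>s\<in>driving_sources. source_value Z U C s \<omega>)"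
proof (rule ext, rule restrict_ext)
  show "source_value (\<lambda>_. 0) U C s \<omega> = source_value Z U C s \<omega>" if "s \<in> driving_sources" for s \<omega>
    using that by (cases s) (auto simp: driving_sources_iff)
qed

lemma driving_values_measurable:
  assumes noise: "exchange_noise M \<mu> Z U C"
  shows "driving_values U C \<in> M \<rightarrow>\<^sub>M driving_algebra"
  unfolding driving_values_eq[of U C Z]
  by (rule measurable_restrict, rule source_value_random_variable[OF noise])
    (simp add: driving_sources_def)

lemma driving_law:
  assumes noise: "exchange_noise M \<mu> Z U C"
  shows "distr M driving_algebra (driving_values U C)
    = PiM driving_sources (\<lambda>s. distr M value_algebra (source_value Z U C s))"
proof -
  interpret prob_space M by (rule noise_prob_space[OF noise])
  have sub: "driving_sources \<subseteq> sources" by (auto simp: driving_sources_def)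
  have ne: "driving_sources \<noteq> {}" using driving_sources_iff(2) by blast
  show ?thesis
    unfolding driving_values_eq[of U C Z]
    using indep_vars_iff_distr_eq_PiM'[OF ne, where M' = "\<lambda>_. value_algebra" and X = "source_value Z U C"]
      indep_vars_subset[OF sources_independent[OF noise] sub]
      source_value_random_variable[OF noise] sub by blast
qed

text \<open>Independence makes the joint law the product of the marginals, and the marginals are
  prescribed. This lets the noise of one probability space replace the noise of another.\<close>

lemma driving_law_unique:
  fixes Z :: "'a \<Rightarrow> real ^ 'n" and Z' :: "'b \<Rightarrow> real ^ 'n"
  assumes "exchange_noise M \<mu> Z U C" "exchange_noise M' \<mu>' Z' U' C'"
  shows "distr M driving_algebra (driving_values U C) = distr M' driving_algebra (driving_values U' C')"
  unfolding driving_law[OF assms(1)] driving_law[OF assms(2)]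
  by (rule PiM_cong) (use source_value_law_unique[OF assms] in blast)+

text \<open>The groups \<open>{Init}\<close> and \<open>driving_sources\<close> of an independent family are disjoint, hence
  independent of each other; projecting the one-member family on \<open>{Init}\<close> to its state component
  gives the initial state itself.\<close>

lemma joint_law_product:
  fixes Z :: "'a \<Rightarrow> real ^ 'n"
  assumes noise: "exchange_noise M \<mu> Z U C"
  shows "distr M (borel \<Otimes>\<^sub>M driving_algebra) (\<lambda>\<omega>. (Z \<omega>, driving_values U C \<omega>))
    = distr M borel Z \<Otimes>\<^sub>M distr M driving_algebra (driving_values U C)"
proof -
  interpret prob_space M by (rule noise_prob_space[OF noise])
  let ?A = "PiM {Init :: 'n source} (\<lambda>_. value_algebra)" and ?D = driving_algebra
  let ?init = "\<lambda>\<omega>. \<lambda>s\<in>{Init}. source_value Z U C s \<omega>" and ?drive = "driving_values U C"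
  have "indep_var ?A ?init ?D (\<lambda>\<omega>. \<lambda>s\<in>driving_sources. source_value Z U C s \<omega>)"
    by (rule indep_var_restrict[OF sources_independent[OF noise]])
      (auto simp: driving_sources_def sources_def)
  then have "indep_var ?A ?init ?D ?drive"
    by (simp only: driving_values_eq[of U C Z])
  then have init: "?init \<in> M \<rightarrow>\<^sub>M ?A" and drive: "?drive \<in> M \<rightarrow>\<^sub>M ?D"
    and joint: "distr M ?A ?init \<Otimes>\<^sub>M distr M ?D ?drive
      = distr M (?A \<Otimes>\<^sub>M ?D) (\<lambda>\<omega>. (?init \<omega>, ?drive \<omega>))"
    unfolding indep_var_distribution_eq by - (elim conjE; assumption)+
  have component: "(\<lambda>v. v Init) \<in> ?A \<rightarrow>\<^sub>M value_algebra"
    by (rule measurable_component_singleton) simp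
  have h: "(\<lambda>v. fst (v Init)) \<in> ?A \<rightarrow>\<^sub>M borel"
    using measurable_compose[OF component measurable_fst] .
  have hd: "(\<lambda>v. fst (v Init)) \<in> distr M ?A ?init \<rightarrow>\<^sub>M borel"
    by (subst measurable_cong_sets[OF sets_distr refl]) (rule h)
  have h': "(\<lambda>(v, w). (fst (v Init), w)) \<in> ?A \<Otimes>\<^sub>M ?D \<rightarrow>\<^sub>M borel \<Otimes>\<^sub>M ?D"
    unfolding case_prod_beta'
    by (intro measurable_Pair measurable_compose[OF measurable_fst h] measurable_snd)
  have Z: "(\<lambda>v. fst (v Init)) \<circ> ?init = Z"
    by (simp add: fun_eq_iff)
  have drive_id: "distr (distr M ?D ?drive) ?D (\<lambda>w. w) = distr M ?D ?drive"
    by (rule distr_id2) (rule sets_distr[symmetric])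
  then have drive_sigma_finite: "sigma_finite_measure (distr (distr M ?D ?drive) ?D (\<lambda>w. w))"
    using prob_space_imp_sigma_finite[OF prob_space_distr[OF drive]] by (simp only:)
  have "distr M (borel \<Otimes>\<^sub>M ?D) (\<lambda>\<omega>. (Z \<omega>, ?drive \<omega>))
      = distr (distr M (?A \<Otimes>\<^sub>M ?D) (\<lambda>\<omega>. (?init \<omega>, ?drive \<omega>))) (borel \<Otimes>\<^sub>M ?D)
          (\<lambda>(v, w). (fst (v Init), w))"
    unfolding distr_distr[OF h' measurable_Pair[OF init drive]]
    by (simp only: o_def prod.case restrict_apply' singletonI source_value.simps fst_conv)
  also have "\<dots> = distr (distr M ?A ?init \<Otimes>\<^sub>M distr M ?D ?drive) (borel \<Otimes>\<^sub>M ?D)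
          (\<lambda>(v, w). (fst (v Init), w))"
    by (simp only: joint)
  also have "\<dots> = distr (distr M ?A ?init) borel (\<lambda>v. fst (v Init)) \<Otimes>\<^sub>M distr (distr M ?D ?drive) ?D (\<lambda>w. w)"
    by (rule pair_measure_distr[OF hd _ drive_sigma_finite, symmetric]) (rule measurable_ident_sets, rule sets_distr)
  also have "distr (distr M ?A ?init) borel (\<lambda>v. fst (v Init)) = distr M borel Z"
    by (simp only: distr_distr[OF h init] Z)
  also have "distr (distr M ?D ?drive) ?D (\<lambda>w. w) = distr M ?D ?drive"
    by (rule drive_id)
  finally show ?thesis .
qed

section \<open>The flow driven by random sources\<close>

abbreviation driven_flow ::
  "('n \<times> 'n \<Rightarrow> nat \<Rightarrow> 'a \<Rightarrow> real) \<Rightarrow> (nat \<Rightarrow> 'a \<Rightarrow> 'n \<times> 'n) \<Rightarrow> real ^ 'n \<Rightarrow> 'a \<Rightarrow> nat \<Rightarrow> real ^ 'n" where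
  "driven_flow U C z \<omega> \<equiv> exchange_flow (\<lambda>k. C k \<omega>) (\<lambda>k. U (C k \<omega>) k \<omega>) z"

lemma driven_flow_in_path_space:
  assumes "exchange_noise M \<mu> Z U C" "\<omega> \<in> space M" "z \<in> prob_simplex"
  shows "driven_flow U C z \<omega> \<in> path_space"
  using noise_choice_in_pairs[OF assms(1,2)] noise_uniform_in_unit_interval[OF assms(1,2)] assms(3) by (rule exchange_flow_in_path_space)

lemma driven_flow_measurable:
  assumes C: "\<And>k. C k \<in> M \<rightarrow>\<^sub>M count_space ordered_pairs"
    and U: "\<And>p k. p \<in> ordered_pairs \<Longrightarrow> U p k \<in> borel_measurable M"
    and Z: "Z \<in> borel_measurable M"
  shows "(\<lambda>\<omega>. driven_flow U C (Z \<omega>) \<omega>) \<in> borel_measurable M"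
  by (rule driven_process_measurable[where step = continuous_step and C = C and U = U
        and Y = "\<lambda>k \<omega>. driven_flow U C (Z \<omega>) \<omega> k", OF continuous_step_measurable C U])
    (use Z in simp_all)

text \<open>Together with the reader of choices below, this makes the product space of the driving sources
  itself a space with driving variables, on which the flow can be run.\<close>

definition read_uniform :: "'n \<times> 'n \<Rightarrow> nat \<Rightarrow>
    ('n source \<Rightarrow> (real ^ 'n) \<times> real \<times> ('n \<times> 'n)) \<Rightarrow> real" where
  "read_uniform p k w = fst (snd (w (Unif p k)))"

definition read_choice :: "nat \<Rightarrow>
    ('n source \<Rightarrow> (real ^ 'n) \<times> real \<times> ('n \<times> 'n)) \<Rightarrow> 'n \<times> 'n" where
  "read_choice k w = snd (snd (w (Choice k)))"

lemma read_measurable: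
  "p \<in> ordered_pairs \<Longrightarrow> read_uniform p k \<in> borel_measurable driving_algebra"
  "read_choice k \<in> driving_algebra \<rightarrow>\<^sub>M count_space ordered_pairs"
proof -
  assume "p \<in> ordered_pairs"
  then have "(\<lambda>w. w (Unif p k)) \<in> driving_algebra \<rightarrow>\<^sub>M value_algebra"
    by (intro measurable_component_singleton) (simp add: driving_sources_iff)
  from measurable_compose[OF measurable_compose[OF this measurable_snd] measurable_fst]
  show "read_uniform p k \<in> borel_measurable driving_algebra"
    by (simp only: read_uniform_def[abs_def])
next
  have "(\<lambda>w. w (Choice k)) \<in> driving_algebra \<rightarrow>\<^sub>M value_algebra"
    by (intro measurable_component_singleton) (simp add: driving_sources_iff)
  from measurable_compose[OF measurable_compose[OF this measurable_snd] measurable_snd]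
  show "read_choice k \<in> driving_algebra \<rightarrow>\<^sub>M count_space ordered_pairs"
    by (simp only: read_choice_def[abs_def])
qed

lemma driven_flow_read:
  assumes "exchange_noise M \<mu> Z U C" "\<omega> \<in> space M"
  shows "driven_flow read_uniform read_choice z (driving_values U C \<omega>) = driven_flow U C z \<omega>"
  using noise_choice_in_pairs[OF assms]
  by (simp add: read_uniform_def read_choice_def driving_sources_iff)

text \<open>The mean splits by Fubini into an average over the initial state and an average over
  the noise. The inner average may be taken on any other probability space that carries exchange
  noise; choosing the one of the limit process makes the inner function of the initial state the
  same for all discrete processes.\<close>

lemma expectation_by_conditioning_on_initial_state:
  fixes Z :: "'a \<Rightarrow> real ^ 'n" and Z' :: "'b \<Rightarrow> real ^ 'n" and f :: "(nat \<Rightarrow> real ^ 'n) \<Rightarrow> real"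
  assumes noise: "exchange_noise M \<mu> Z U C" and noise': "exchange_noise M' \<mu>' Z' U' C'"
    and f: "continuous_on path_space f" "\<And>x. x \<in> path_space \<Longrightarrow> \<bar>f x\<bar> \<le> B"
  shows "(\<integral>\<omega>. f (driven_flow U C (Z \<omega>) \<omega>) \<partial>M)
    = (\<integral>\<omega>. (\<integral>\<omega>'. f (driven_flow U' C' (Z \<omega>) \<omega>') \<partial>M') \<partial>M)"
proof -
  interpret M: prob_space M by (rule noise_prob_space[OF noise])
  interpret M': prob_space M' by (rule noise_prob_space[OF noise'])
  let ?P = "distr M borel Z" and ?Q = "distr M driving_algebra (driving_values U C)"
  note dm = driving_values_measurable[OF noise]
  note dm' = driving_values_measurable[OF noise']
  note Zm = noise_init_measurable[OF noise]
  interpret P: prob_space ?P by (rule M.prob_space_distr[OF Zm])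
  interpret Q: prob_space ?Q by (rule M.prob_space_distr[OF dm])
  interpret PQ: pair_prob_space ?P ?Q ..
  \<comment> \<open>Fubini needs a functional that is measurable on all sequences, so \<open>f\<close> is cut off outside path space.\<close>
  define g where "g x = indicator path_space x *\<^sub>R f x" for x
  have "path_space \<in> sets (borel :: (nat \<Rightarrow> real ^ 'n) measure)"
    using compact_path_space by (intro borel_closed compact_imp_closed)
  then have g: "g \<in> borel_measurable borel"
    unfolding g_def using f(1) by (rule borel_measurable_continuous_on_indicator)
  have B: "0 \<le> B"
  proof -
    obtain \<omega> where \<omega>: "\<omega> \<in> space M" using M.not_empty by blast
    have "driven_flow U C (Z \<omega>) \<omega> \<in> path_space"
      by (rule driven_flow_in_path_space[OF noise \<omega> noise_init_in_simplex[OF noise \<omega>]])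
    from order_trans[OF abs_ge_zero f(2)[OF this]] show ?thesis .
  qed
  have g_bound: "norm (g x) \<le> B" for x
    using f(2) B by (auto simp: g_def indicator_def)
  define F where "F = (\<lambda>v. g (driven_flow read_uniform read_choice (fst v) (snd v)))"
  have F: "F \<in> borel_measurable (borel \<Otimes>\<^sub>M driving_algebra)"
  proof -
    have "(\<lambda>v. driven_flow (\<lambda>p k v. read_uniform p k (snd v)) (\<lambda>k v. read_choice k (snd v)) (fst v) v)
        \<in> borel_measurable (borel \<Otimes>\<^sub>M driving_algebra)"
      by (intro driven_flow_measurable measurable_compose[OF measurable_snd read_measurable(1)]
          measurable_compose[OF measurable_snd read_measurable(2)] measurable_fst)
    from measurable_compose[OF this g] show ?thesis by (simp only: F_def)
  qed
  have F_at: "F (z, driving_values V D \<omega>) = f (driven_flow V D z \<omega>)"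
    if "exchange_noise L \<nu> W V D" "\<omega> \<in> space L" "z \<in> prob_simplex" for L :: "'c measure" and \<nu> W V D \<omega> z
    using driven_flow_in_path_space[OF that]
    by (simp only: F_def g_def fst_conv snd_conv driven_flow_read[OF that(1,2)] indicator_simps scaleR_one)
  have F_bound: "norm (F v) \<le> B" for v
    unfolding F_def by (rule g_bound)
  have F_PQ: "F \<in> borel_measurable (?P \<Otimes>\<^sub>M ?Q)"
    by (subst measurable_cong_sets[OF sets_pair_measure_cong[OF sets_distr sets_distr] refl]) (rule F)
  have "(\<integral>\<omega>. f (driven_flow U C (Z \<omega>) \<omega>) \<partial>M) = (\<integral>\<omega>. F (Z \<omega>, driving_values U C \<omega>) \<partial>M)"
    by (rule Bochner_Integration.integral_cong[OF refl],
        rule F_at[OF noise _ noise_init_in_simplex[OF noise], symmetric])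
  also have "\<dots> = integral\<^sup>L (distr M (borel \<Otimes>\<^sub>M driving_algebra) (\<lambda>\<omega>. (Z \<omega>, driving_values U C \<omega>))) F"
    by (rule integral_distr[symmetric, OF measurable_Pair[OF Zm dm] F])
  also have "\<dots> = integral\<^sup>L (?P \<Otimes>\<^sub>M ?Q) F"
    by (simp only: joint_law_product[OF noise])
  also have "\<dots> = (\<integral>z. (\<integral>w. F (z, w) \<partial>?Q) \<partial>?P)"
    using F_bound by (intro PQ.integral_fst'[symmetric] PQ.P.integrable_const_bound[OF AE_I2 F_PQ])
  also have "\<dots> = (\<integral>\<omega>. (\<integral>w. F (Z \<omega>, w) \<partial>?Q) \<partial>M)"
  proof (rule integral_distr[OF Zm])
    show "(\<lambda>z. \<integral>w. F (z, w) \<partial>?Q) \<in> borel_measurable borel"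
    proof (rule Q.borel_measurable_lebesgue_integral)
      show "(\<lambda>(z, w). F (z, w)) \<in> borel_measurable (borel \<Otimes>\<^sub>M ?Q)"
        unfolding case_prod_eta
        by (subst measurable_cong_sets[OF sets_pair_measure_cong[OF refl sets_distr] refl]) (rule F)
    qed
  qed
  also have "\<dots> = (\<integral>\<omega>. (\<integral>\<omega>'. f (driven_flow U' C' (Z \<omega>) \<omega>') \<partial>M') \<partial>M)"
  proof (rule Bochner_Integration.integral_cong[OF refl])
    fix \<omega> assume "\<omega> \<in> space M"
    then have z: "Z \<omega> \<in> prob_simplex" by (rule noise_init_in_simplex[OF noise])
    have Fz: "(\<lambda>w. F (Z \<omega>, w)) \<in> borel_measurable driving_algebra"
      by (rule measurable_compose[OF measurable_Pair1' F]) simp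
    have "(\<integral>w. F (Z \<omega>, w) \<partial>?Q) = (\<integral>\<omega>'. F (Z \<omega>, driving_values U' C' \<omega>') \<partial>M')"
      unfolding driving_law_unique[OF noise noise'] by (rule integral_distr[OF dm' Fz])
    also have "\<dots> = (\<integral>\<omega>'. f (driven_flow U' C' (Z \<omega>) \<omega>') \<partial>M')"
      by (rule Bochner_Integration.integral_cong[OF refl], rule F_at[OF noise' _ z])
    finally show "(\<integral>w. F (Z \<omega>, w) \<partial>?Q) = (\<integral>\<omega>'. f (driven_flow U' C' (Z \<omega>) \<omega>') \<partial>M')" .
  qed
  finally show ?thesis .
qed

section \<open>Comparison of expectations\<close>

lemma integrable_path_functional:
  fixes f :: "(nat \<Rightarrow> real ^ 'n) \<Rightarrow> real"
  assumes "prob_space M" "P \<in> borel_measurable M" "\<And>\<omega>. \<omega> \<in> space M \<Longrightarrow> P \<omega> \<in> path_space"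
    and f: "continuous_on path_space f" "\<And>x. x \<in> path_space \<Longrightarrow> \<bar>f x\<bar> \<le> B"
  shows "integrable M (\<lambda>\<omega>. f (P \<omega>))"
proof -
  interpret prob_space M by fact
  have "f \<in> borel_measurable (borel_of (top_of_set path_space))"
    using f(1) by (intro borel_measurable_of_continuous_map) simp
  from measurable_compose[OF measurable_into_borel_of_subset[OF assms(2,3)] this]
  have meas: "(\<lambda>\<omega>. f (P \<omega>)) \<in> borel_measurable M" by blast
  have "norm (f (P \<omega>)) \<le> B" if "\<omega> \<in> space M" for \<omega>
    using f(2)[OF assms(3)[OF that]] by simp
  from integrable_const_bound[OF AE_I2[OF this] meas] show ?thesis .
qed

lemma expectation_diff_le:
  fixes F G :: "'a \<Rightarrow> real"
  assumes "prob_space M" "integrable M F" "integrable M G"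
    and close: "\<And>\<omega>. \<omega> \<in> space M \<Longrightarrow> \<bar>F \<omega> - G \<omega>\<bar> \<le> e"
  shows "\<bar>integral\<^sup>L M F - integral\<^sup>L M G\<bar> \<le> e"
proof -
  interpret prob_space M by fact
  have "\<bar>integral\<^sup>L M (\<lambda>\<omega>. F \<omega> - G \<omega>)\<bar> \<le> (\<integral>\<omega>. \<bar>F \<omega> - G \<omega>\<bar> \<partial>M)"
    by (rule integral_abs_bound)
  also have "\<dots> \<le> (\<integral>\<omega>. e \<partial>M)"
    using assms by (intro integral_mono) auto
  finally show ?thesis
    using assms by (simp add: prob_space)
qed

lemma integrable_driven_flow:
  fixes f :: "(nat \<Rightarrow> real ^ 'n) \<Rightarrow> real"
  assumes noise: "exchange_noise M \<mu> Z U C"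
    and W: "W \<in> borel_measurable M" "\<And>\<omega>. \<omega> \<in> space M \<Longrightarrow> W \<omega> \<in> prob_simplex"
    and f: "continuous_on path_space f" "\<And>x. x \<in> path_space \<Longrightarrow> \<bar>f x\<bar> \<le> B"
  shows "integrable M (\<lambda>\<omega>. f (driven_flow U C (W \<omega>) \<omega>))"
  by (rule integrable_path_functional[OF noise_prob_space[OF noise]
        driven_flow_measurable[OF noise_choice_measurable[OF noise] noise_uniform_measurable[OF noise] W(1)]
        driven_flow_in_path_space[OF noise _ W(2)] f])

text \<open>Flows from nearby initial states with the same noise stay close at all times, so the
  functional changes little for every outcome and so does its mean.\<close>

lemma expected_flow_continuous:
  fixes f :: "(nat \<Rightarrow> real ^ 'n) \<Rightarrow> real"
  assumes noise: "exchange_noise M \<mu> Z U C"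
    and f: "continuous_on path_space f" "\<And>x. x \<in> path_space \<Longrightarrow> \<bar>f x\<bar> \<le> B"
  shows "continuous_on prob_simplex (\<lambda>z. \<integral>\<omega>. f (driven_flow U C z \<omega>) \<partial>M)"
proof (rule continuous_onI)
  fix z :: "real ^ 'n" and e :: real
  assume z: "z \<in> prob_simplex" and "e > 0"
  obtain K d where d: "d > 0" and close: "\<And>x y. x \<in> path_space \<Longrightarrow> y \<in> path_space \<Longrightarrow>
      (\<And>k. k \<le> K \<Longrightarrow> l1_dist (x k) (y k) < d) \<Longrightarrow> \<bar>f x - f y\<bar> < e"
    using path_functional_uniformly_continuous[OF f(1) \<open>e > 0\<close>] by metis
  let ?N = "real CARD('n)"
  show "\<exists>\<delta>>0. \<forall>y\<in>prob_simplex. dist y z < \<delta> \<longrightarrow>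
      dist (\<integral>\<omega>. f (driven_flow U C y \<omega>) \<partial>M) (\<integral>\<omega>. f (driven_flow U C z \<omega>) \<partial>M) \<le> e"
  proof (intro exI[of _ "d / ?N"] conjI ballI impI)
    show "d / ?N > 0" using d by simp
    fix y :: "real ^ 'n" assume y: "y \<in> prob_simplex" and near: "dist y z < d / ?N"
    have "l1_dist y z \<le> ?N * dist y z"
      unfolding l1_dist_def dist_norm
      using sum_bounded_above[of UNIV "\<lambda>i. \<bar>y $ i - z $ i\<bar>" "norm (y - z)"]
        component_le_norm_cart[of "y - z"] by simp
    also have "\<dots> < d" using near by (simp add: less_divide_eq mult.commute)
    finally have "l1_dist y z < d" .
    have "\<bar>f (driven_flow U C y \<omega>) - f (driven_flow U C z \<omega>)\<bar> < e" if \<omega>: "\<omega> \<in> space M" for \<omega>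
    proof (rule close)
      show "l1_dist (driven_flow U C y \<omega> k) (driven_flow U C z \<omega> k) < d" for k
        using noise_choice_in_pairs[OF noise \<omega>] noise_uniform_in_unit_interval[OF noise \<omega>] \<open>l1_dist y z < d\<close>
        by (intro le_less_trans[OF exchange_flow_nonexpansive])
    qed (rule driven_flow_in_path_space[OF noise \<omega>] y z)+
    then show "dist (\<integral>\<omega>. f (driven_flow U C y \<omega>) \<partial>M) (\<integral>\<omega>. f (driven_flow U C z \<omega>) \<partial>M) \<le> e"
      unfolding dist_real_def
      by (intro expectation_diff_le less_imp_le noise_prob_space[OF noise]
          integrable_driven_flow[OF noise _ _ f] borel_measurable_const y z)
  qed
qed

lemma continuous_process_eq_driven_flow:
  assumes "continuous_exchange_process M \<mu> U C X" "\<omega> \<in> space M"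
  shows "(\<lambda>k. X k \<omega>) = driven_flow U C (X 0 \<omega>) \<omega>"
proof
  show "X k \<omega> = driven_flow U C (X 0 \<omega>) \<omega> k" for k
    using assms unfolding continuous_exchange_process_def by (induction k) auto
qed

lemma discrete_process_near_driven_flow:
  assumes n: "n \<ge> 1" and Y: "discrete_exchange_process n M \<mu> U C Y"
  shows "(\<lambda>\<omega> k. Y k \<omega>) \<in> borel_measurable M"
    and "\<And>\<omega>. \<omega> \<in> space M \<Longrightarrow> (\<lambda>k. Y k \<omega>) \<in> path_space"
    and "\<And>\<omega> k. \<omega> \<in> space M \<Longrightarrow>
      l1_dist (Y k \<omega>) (driven_flow U C (Y 0 \<omega>) \<omega> k) \<le> 2 * real k / real n"
proof -
  have noise: "exchange_noise M \<mu> (Y 0) U C"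
    and step: "\<And>k \<omega>. \<omega> \<in> space M \<Longrightarrow> Y (Suc k) \<omega> = discrete_step n (C k \<omega>) (U (C k \<omega>) k \<omega>) (Y k \<omega>)"
    using Y unfolding discrete_exchange_process_def by blast+
  show "(\<lambda>\<omega> k. Y k \<omega>) \<in> borel_measurable M"
    by (rule driven_process_measurable[OF discrete_step_measurable noise_choice_measurable[OF noise]
          noise_uniform_measurable[OF noise] noise_init_measurable[OF noise] step])
  fix \<omega> assume \<omega>: "\<omega> \<in> space M"
  note near = discrete_path_near_exchange_flow[where y = "\<lambda>k. Y k \<omega>", OF n
      noise_choice_in_pairs[OF noise \<omega>] noise_uniform_in_unit_interval[OF noise \<omega>] noise_init_in_simplex[OF noise \<omega>] step[OF \<omega>]]
  show "(\<lambda>k. Y k \<omega>) \<in> path_space" by (rule near)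
  show "l1_dist (Y k \<omega>) (driven_flow U C (Y 0 \<omega>) \<omega> k) \<le> 2 * real k / real n" for k by (rule near)
qed

lemma path_law_prob_and_integral:
  fixes f :: "(nat \<Rightarrow> real ^ 'n) \<Rightarrow> real"
  assumes "prob_space M" "(\<lambda>\<omega> k. Y k \<omega>) \<in> borel_measurable M"
    and "\<And>\<omega>. \<omega> \<in> space M \<Longrightarrow> (\<lambda>k. Y k \<omega>) \<in> path_space"
  shows "borel_prob_on path_topology (path_law M Y)"
    and "continuous_on path_space f \<Longrightarrow> (\<integral>x. f x \<partial>path_law M Y) = (\<integral>\<omega>. f (\<lambda>k. Y k \<omega>) \<partial>M)"
proof -
  have meas: "(\<lambda>\<omega> k. Y k \<omega>) \<in> M \<rightarrow>\<^sub>M borel_of path_topology"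
    unfolding path_topology_eq by (rule measurable_into_borel_of_subset[OF assms(2,3)])
  show "borel_prob_on path_topology (path_law M Y)"
    unfolding borel_prob_on_def path_law_def
    using prob_space.prob_space_distr[OF assms(1) meas] by simp
  assume "continuous_on path_space f"
  then have "f \<in> borel_measurable (borel_of path_topology)"
    unfolding path_topology_eq by (intro borel_measurable_of_continuous_map) simp
  then show "(\<integral>x. f x \<partial>path_law M Y) = (\<integral>\<omega>. f (\<lambda>k. Y k \<omega>) \<partial>M)"
    unfolding path_law_def by (rule integral_distr[OF meas])
qed

theorem theorem2p1:
  fixes M :: "nat \<Rightarrow> 'a measure" and M_inf :: "'b measure"
    and mu :: "nat \<Rightarrow> (real ^ 'n) measure" and mu_inf :: "(real ^ 'n) measure"
    and U :: "nat \<Rightarrow> 'n \<times> 'n \<Rightarrow> nat \<Rightarrow> 'a \<Rightarrow> real"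
    and U_inf :: "'n \<times> 'n \<Rightarrow> nat \<Rightarrow> 'b \<Rightarrow> real"
    and C :: "nat \<Rightarrow> nat \<Rightarrow> 'a \<Rightarrow> 'n \<times> 'n" and C_inf :: "nat \<Rightarrow> 'b \<Rightarrow> 'n \<times> 'n"
    and Y :: "nat \<Rightarrow> nat \<Rightarrow> 'a \<Rightarrow> real ^ 'n" and X :: "nat \<Rightarrow> 'b \<Rightarrow> real ^ 'n"
  assumes "CARD('n) \<ge> 2"
    and "\<And>n. n \<ge> 1 \<Longrightarrow> borel_prob_on simplex_topology (mu n)"
    and "\<And>n. n \<ge> 1 \<Longrightarrow> emeasure (mu n) (prob_simplex_grid n) = 1"
    and "borel_prob_on simplex_topology mu_inf"
    and "\<And>n. n \<ge> 1 \<Longrightarrow> discrete_exchange_process n (M n) (mu n) (U n) (C n) (Y n)"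
    and "continuous_exchange_process M_inf mu_inf U_inf C_inf X"
    and "weakly_converges_on simplex_topology mu mu_inf"
    and "weakly_converges_on uniforms_topology (\<lambda>n. uniforms_law (M n) (U n)) (uniforms_law M_inf U_inf)"
  shows "weakly_converges_on path_topology (\<lambda>n. path_law (M n) (Y n)) (path_law M_inf X)"
proof -
  note Y = assms(5) and X = assms(6) and initial = assms(7)
  have noise: "exchange_noise (M n) (mu n) (Y n 0) (U n) (C n)" if "n \<ge> 1" for n
    using Y[OF that] unfolding discrete_exchange_process_def by (rule conjunct1)
  have noise_inf: "exchange_noise M_inf mu_inf (X 0) U_inf C_inf"
    using X unfolding continuous_exchange_process_def by (rule conjunct1)
  note near = discrete_process_near_driven_flow[OF _ Y]
  note X_eq = continuous_process_eq_driven_flow[OF X]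
  have X_in: "(\<lambda>k. X k \<omega>) \<in> path_space" if "\<omega> \<in> space M_inf" for \<omega>
    unfolding X_eq[OF that]
    by (rule driven_flow_in_path_space[OF noise_inf that noise_init_in_simplex[OF noise_inf that]])
  have X_meas: "(\<lambda>\<omega> k. X k \<omega>) \<in> borel_measurable M_inf"
    by (rule measurable_cong[THEN iffD2, OF X_eq], assumption)
      (rule driven_flow_measurable[OF noise_choice_measurable[OF noise_inf] noise_uniform_measurable[OF noise_inf]
          noise_init_measurable[OF noise_inf]])
  show ?thesis
    unfolding weakly_converges_on_def
  proof (intro conjI allI impI)
    show "\<forall>\<^sub>F n in sequentially. borel_prob_on path_topology (path_law (M n) (Y n))"
      using eventually_ge_at_top[of 1] by (rule eventually_mono)
        (rule path_law_prob_and_integral(1)[OF noise_prob_space[OF noise] near(1) near(2)])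
    show "borel_prob_on path_topology (path_law M_inf X)"
      by (rule path_law_prob_and_integral(1)[OF noise_prob_space[OF noise_inf] X_meas X_in])
    fix f :: "(nat \<Rightarrow> real ^ 'n) \<Rightarrow> real"
    assume "continuous_map path_topology euclideanreal f \<and> bounded (f ` topspace path_topology)"
    then have f: "continuous_on path_space f" and "bounded (f ` path_space)"
      unfolding path_topology_eq by auto
    then obtain B where B: "\<And>x. x \<in> path_space \<Longrightarrow> \<bar>f x\<bar> \<le> B"
      unfolding bounded_iff by auto
    define h where "h z = (\<integral>\<omega>. f (driven_flow U_inf C_inf z \<omega>) \<partial>M_inf)" for z
    have h: "continuous_map simplex_topology euclideanreal h"
      unfolding h_def simplex_topology_def
      using expected_flow_continuous[OF noise_inf f B] by simp
    then have "continuous_on prob_simplex h"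
      unfolding simplex_topology_def by simp
    then have "compact (h ` prob_simplex)"
      by (rule compact_continuous_image[OF _ compact_prob_simplex])
    then have h_bounded: "bounded (h ` topspace simplex_topology)"
      unfolding simplex_topology_def by (simp add: compact_imp_bounded)
    have h_meas: "h \<in> borel_measurable (borel_of simplex_topology)"
      by (rule borel_measurable_of_continuous_map[OF h])
    have flow_mean: "(\<integral>\<omega>. f (driven_flow V D (W \<omega>) \<omega>) \<partial>L) = (\<integral>z. h z \<partial>\<nu>)"
      if L: "exchange_noise L \<nu> W V D" for L :: "'c measure" and \<nu> W V D
    proof -
      have "(\<integral>\<omega>. f (driven_flow V D (W \<omega>) \<omega>) \<partial>L) = (\<integral>\<omega>. h (W \<omega>) \<partial>L)"
        unfolding h_def by (rule expectation_by_conditioning_on_initial_state[OF L noise_inf f B])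
      also have "\<dots> = (\<integral>z. h z \<partial>\<nu>)"
        unfolding noise_init_law[OF L]
        by (rule integral_distr[symmetric, OF noise_init_borel_of[OF L] h_meas])
      finally show ?thesis .
    qed
    have mean_Y: "(\<integral>x. f x \<partial>path_law (M n) (Y n)) = (\<integral>\<omega>. f (\<lambda>k. Y n k \<omega>) \<partial>M n)" if "n \<ge> 1" for n
      by (rule path_law_prob_and_integral(2)[OF noise_prob_space[OF noise[OF that]]
            near(1)[OF that that] near(2)[OF that that] f])
    have mean_X: "(\<integral>x. f x \<partial>path_law M_inf X) = (\<integral>\<omega>. f (\<lambda>k. X k \<omega>) \<partial>M_inf)"
      by (rule path_law_prob_and_integral(2)[OF noise_prob_space[OF noise_inf] X_meas X_in f])
    \<comment> \<open>By \<open>flow_mean\<close> the second integral is the mean of \<open>f\<close> under the flow driven by the \<open>n\<close>-th noise.\<close>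
    have "(\<lambda>n. (\<integral>\<omega>. f (\<lambda>k. Y n k \<omega>) \<partial>M n) - (\<integral>z. h z \<partial>mu n)) \<longlonglongrightarrow> 0"
    proof (rule LIMSEQ_I)
      fix r :: real assume "r > 0"
      then have "r / 2 > 0" by simp
      obtain K d where d: "d > 0" and close: "\<And>x y. x \<in> path_space \<Longrightarrow> y \<in> path_space \<Longrightarrow>
          (\<And>k. k \<le> K \<Longrightarrow> l1_dist (x k) (y k) < d) \<Longrightarrow> \<bar>f x - f y\<bar> < r / 2"
        using path_functional_uniformly_continuous[OF f \<open>r / 2 > 0\<close>] by metis
      \<comment> \<open>From \<open>n0\<close> on, the coupling error \<open>2 * k / n\<close> is below \<open>d\<close> at all times \<open>k \<le> K\<close>.\<close>
      obtain n0 where n0: "2 * real K / d < real n0" using reals_Archimedean2 by blast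
      have "\<bar>(\<integral>\<omega>. f (\<lambda>k. Y n k \<omega>) \<partial>M n) - (\<integral>z. h z \<partial>mu n)\<bar> \<le> r / 2"
        if n: "n \<ge> max 1 n0" for n
      proof -
        have n1: "n \<ge> 1" using n by simp
        have small: "2 * real k / real n < d" if "k \<le> K" for k
        proof -
          have "2 * real k \<le> 2 * real K" using that by simp
          also have "\<dots> < real n0 * d" using n0 d by (simp add: divide_less_eq)
          also have "\<dots> \<le> real n * d" using n d by simp
          finally show ?thesis using n1 by (simp add: divide_less_eq mult.commute)
        qed
        have "\<bar>f (\<lambda>k. Y n k \<omega>) - f (driven_flow (U n) (C n) (Y n 0 \<omega>) \<omega>)\<bar> \<le> r / 2"
          if \<omega>: "\<omega> \<in> space (M n)" for \<omega>
        proof (rule less_imp_le, rule close)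
          show "l1_dist (Y n k \<omega>) (driven_flow (U n) (C n) (Y n 0 \<omega>) \<omega> k) < d" if "k \<le> K" for k
            by (rule le_less_trans[OF near(3)[OF n1 n1 \<omega>] small[OF that]])
        qed (rule near(2)[OF n1 n1 \<omega>]
            driven_flow_in_path_space[OF noise[OF n1] \<omega> noise_init_in_simplex[OF noise[OF n1] \<omega>]])+
        then have "\<bar>(\<integral>\<omega>. f (\<lambda>k. Y n k \<omega>) \<partial>M n)
            - (\<integral>\<omega>. f (driven_flow (U n) (C n) (Y n 0 \<omega>) \<omega>) \<partial>M n)\<bar> \<le> r / 2"
          by (intro expectation_diff_le integrable_path_functional[OF _ _ _ f B]
              integrable_driven_flow[OF noise[OF n1] _ _ f B] noise_prob_space[OF noise[OF n1]]
              near(1)[OF n1 n1] near(2)[OF n1 n1] noise_init_measurable[OF noise[OF n1]]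
              noise_init_in_simplex[OF noise[OF n1]])
        then show ?thesis unfolding flow_mean[OF noise[OF n1]] .
      qed
      then show "\<exists>n0. \<forall>n\<ge>n0. norm ((\<integral>\<omega>. f (\<lambda>k. Y n k \<omega>) \<partial>M n) - (\<integral>z. h z \<partial>mu n) - 0) < r"
        using \<open>r > 0\<close> by (intro exI[of _ "max 1 n0"]) force
    qed
    moreover have "(\<lambda>n. \<integral>z. h z \<partial>mu n) \<longlonglongrightarrow> (\<integral>z. h z \<partial>mu_inf)"
      using initial h h_bounded unfolding weakly_converges_on_def by blast
    ultimately have "(\<lambda>n. \<integral>\<omega>. f (\<lambda>k. Y n k \<omega>) \<partial>M n) \<longlonglongrightarrow> (\<integral>z. h z \<partial>mu_inf)"
      using tendsto_add by fastforce
    also have "(\<integral>z. h z \<partial>mu_inf) = (\<integral>x. f x \<partial>path_law M_inf X)"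
      unfolding mean_X flow_mean[OF noise_inf, symmetric]
      by (rule Bochner_Integration.integral_cong[OF refl]) (simp only: X_eq)
    finally show "(\<lambda>n. \<integral>x. f x \<partial>path_law (M n) (Y n)) \<longlonglongrightarrow> (\<integral>x. f x \<partial>path_law M_inf X)"
      by (rule Lim_transform_eventually)
        (rule eventually_mono[OF eventually_ge_at_top[of 1]], rule mean_Y[symmetric])
  qed
qed

end
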